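(* Let $A\in\mathbb{R}^{n\times d}$, let $f:\mathbb{R}^n\to\mathbb{R}$ be $\alpha$-strongly convex ($\alpha>0$) and $L$-smooth, and suppose that $x\mapsto f(Ax)$ is $L$-smooth on $\mathbb{R}^d$. Let $g:\mathbb{R}^d\to\mathbb{R}$ be a finite-valued polyhedral convex function, let $F(x)=f(Ax)+g(x)$, and assume the optimal set $\mathcal{X}^*:=\operatorname{argmin}_{x\in\mathbb{R}^d}F(x)$ is nonempty. Let $\mathcal{K}\subseteq\mathbb{R}^d$ be a set containing $\mathcal{X}^*$. Let $H_{\mathcal{K}}$ and $\gamma_{\mathcal{K}}>0$ be the restricted Hoffman constant and the restricted firm convexity constant on $\mathcal{K}$, and let $\|B\|$ be the operator norm of the matrix $B$, all as defined in the context. Assume that the proximal gradient update from a point in $\mathcal{K}$ remains in $\mathcal{K}$. Then $F$ satisfies the $\mathcal{K}$-restricted proximal error bound with constant $$\frac1L+\frac{8}{\alpha}H_{\mathcal{K}}^2\left(1+\frac{\|B\|L}{\gamma_{\mathcal{K}}}\right)^2+\frac{8H_{\mathcal{K}}\|B\|}{\gamma_{\mathcal{K}}},$$ that is, $\operatorname{dist}(x,\mathcal{X}^* )$ is at most this constant times $\|\mathcal{G}_{1/L}(x)\|_2$ for all $x\in\mathcal{K}$.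
   Context: All norms and distances are Euclidean; $\|B\|$ is the induced operator norm. A function is $L$-smooth ($L>0$) if it is continuously differentiable with $L$-Lipschitz gradient. A finite-valued polyhedral convex function is one of the form $g(x)=\max_{1\le i\le m}\{a_i^\top x+b_i\}$ with $a_i\in\mathbb{R}^d$, $b_i\in\mathbb{R}$. Since $f$ is strongly convex, $Ax$ takes a single value $y^*$ for all $x\in\mathcal{X}^*$. Put $\xi^*:=\nabla f(y^* )$ and $$M[\xi^*]:=\operatorname{argmin}_{u\in\mathbb{R}^d}\{g(u)+\langle A^\top\xi^*,u\rangle\}=\{x\in\mathbb{R}^d\mid -A^\top\xi^*\in\partial g(x)\}.$$ This set is polyhedral; fix a matrix $B$ and a vector $c$ with $M[\xi^*]=\{x\in\mathbb{R}^d\mid Bx\le c\}$. Then $\mathcal{X}^*=\{x\mid Ax=y^*,\ Bx\le c\}$. Restricted Hoffman constant: $H_{\mathcal{K}}$ is the smallest constant such that $\operatorname{dist}(x,\mathcal{X}^* )\le H_{\mathcal{K}}\{\|Ax-y^*\|_2+\|(Bx-c)_+\|_2\}$ for all $x\in\mathcal{K}$, where $(\cdot)_+$ is the componentwise positive part. Restricted firm convexity constant of $g$ relative to $-A^\top\xi^*$: $\gamma_{\mathcal{K}}$ is the largest constant $\gamma_{\mathcal{K}}>0$ such that $$g(x)+\langle A^\top\xi^*,x\rangle-\inf_{u\in M[\xi^*]}\bigl(g(u)+\langle A^\top\xi^*,u\rangle\bigr)\ge\frac{\gamma_{\mathcal{K}}}{2}\operatorname{dist}(x,M[\xi^*])^2\quad\text{for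 all }x\in\mathcal{K}.$$ Proximal gradient update: $x^+:=\operatorname{prox}_{g/L}\left(x-\frac1LA^\top\nabla f(Ax)\right)$, where $\operatorname{prox}_{\lambda g}(z):=\operatorname{argmin}_{y}\{g(y)+\frac{1}{2\lambda}\|y-z\|_2^2\}$; the proximal gradient mapping is $\mathcal{G}_{1/L}(x):=L(x-x^+)$. For a constant $\mu>0$, $F$ satisfies the $\mathcal{K}$-restricted proximal error bound with constant $\mu$ if $\operatorname{dist}(x,\mathcal{X}^* )\le\mu\|\mathcal{G}_{1/L}(x)\|_2$ for all $x\in\mathcal{K}\cap\operatorname{dom}(F)$ (here $\operatorname{dom}(F)=\mathbb{R}^d$). *)

theory Defs
  imports "HOL-Analysis.Analysis"
begin

definition argmin_set :: "('a \<Rightarrow> real) \<Rightarrow> 'a set" where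
  "argmin_set h = {x. is_arg_min h (\<lambda>_. True) x}"

definition grad :: "('a::euclidean_space \<Rightarrow> real) \<Rightarrow> 'a \<Rightarrow> 'a" where
  "grad h x = (THE D. GDERIV h x :> D)"

definition L_smooth :: "real \<Rightarrow> ('a::euclidean_space \<Rightarrow> real) \<Rightarrow> bool" where
  "L_smooth L h \<longleftrightarrow> L > 0 \<and> (\<forall>x. GDERIV h x :> grad h x) \<and>
     continuous_on UNIV (grad h) \<and> L-lipschitz_on UNIV (grad h)"

definition strongly_convex :: "real \<Rightarrow> ('a::euclidean_space \<Rightarrow> real) \<Rightarrow> bool" where
  "strongly_convex \<alpha> h \<longleftrightarrow>
     (\<forall>x y t. 0 \<le> t \<and> t \<le> 1 \<longrightarrow>
        h (t *\<^sub>R x + (1 - t) *\<^sub>R y)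
          \<le> t * h x + (1 - t) * h y - \<alpha> / 2 * t * (1 - t) * (norm (x - y))\<^sup>2)"

definition polyhedral_convex :: "('a::euclidean_space \<Rightarrow> real) \<Rightarrow> bool" where
  "polyhedral_convex g \<longleftrightarrow>
     (\<exists>(m::nat) a b. m \<ge> 1 \<and> (\<forall>x. g x = Max ((\<lambda>i. a i \<bullet> x + b i) ` {1..m})))"

definition composite ::
  "real^'d^'n \<Rightarrow> (real^'n \<Rightarrow> real) \<Rightarrow> (real^'d \<Rightarrow> real) \<Rightarrow> real^'d \<Rightarrow> real" where
  "composite A f g x = f (A *v x) + g x"

definition opt_set ::
  "real^'d^'n \<Rightarrow> (real^'n \<Rightarrow> real) \<Rightarrow> (real^'d \<Rightarrow> real) \<Rightarrow> (real^'d) set" where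
  "opt_set A f g = argmin_set (composite A f g)"

text \<open>For strongly convex \<open>f\<close> and nonempty \<open>opt_set A f g\<close>, the common value of
  \<open>A *v x\<close> over all optimal \<open>x\<close>.\<close>
definition opt_image ::
  "real^'d^'n \<Rightarrow> (real^'n \<Rightarrow> real) \<Rightarrow> (real^'d \<Rightarrow> real) \<Rightarrow> real^'n" where
  "opt_image A f g = (THE y. \<forall>x\<in>opt_set A f g. A *v x = y)"

definition tilted ::
  "real^'d^'n \<Rightarrow> (real^'d \<Rightarrow> real) \<Rightarrow> real^'n \<Rightarrow> real^'d \<Rightarrow> real" where
  "tilted A g \<xi> u = g u + (transpose A *v \<xi>) \<bullet> u"

definition M_set :: "real^'d^'n \<Rightarrow> (real^'d \<Rightarrow> real) \<Rightarrow> real^'n \<Rightarrow> (real^'d) set" where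
  "M_set A g \<xi> = argmin_set (tilted A g \<xi>)"

definition pos_part :: "real^'m \<Rightarrow> real^'m" where
  "pos_part v = (\<chi> i. max 0 (v $ i))"

text \<open>Constants range over \<open>H \<ge> 0\<close>: this only matters if \<open>K\<close> is contained in \<open>X\<close>, where
  every real would be admissible and the smallest nonnegative constant is \<open>0\<close>. The set of
  admissible constants is closed, and by Hoffman's lemma it is nonempty when
  \<open>X = {x. A *v x = y \<and> B *v x \<le> c}\<close> is nonempty, so the infimum is its least element.\<close>
definition hoffman_const ::
  "(real^'d) set \<Rightarrow> (real^'d) set \<Rightarrow> real^'d^'n \<Rightarrow> real^'n \<Rightarrow> real^'d^'m \<Rightarrow> real^'m \<Rightarrow> real" where
  "hoffman_const K X A y B c =
     Inf {H. 0 \<le> H \<and>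
        (\<forall>x\<in>K. infdist x X \<le> H * (norm (A *v x - y) + norm (pos_part (B *v x - c))))}"

text \<open>The supremum is attained whenever it is finite. It is \<open>-\<infinity>\<close> if no positive constant is
  admissible, and \<open>\<infinity>\<close> if \<open>K\<close> is contained in \<open>M_set A g \<xi>\<close>, where every positive constant is
  admissible.\<close>
definition firm_const ::
  "(real^'d) set \<Rightarrow> real^'d^'n \<Rightarrow> (real^'d \<Rightarrow> real) \<Rightarrow> real^'n \<Rightarrow> ereal" where
  "firm_const K A g \<xi> =
     Sup (ereal ` {\<gamma>. \<gamma> > 0 \<and>
       (\<forall>x\<in>K. tilted A g \<xi> x - (INF u\<in>M_set A g \<xi>. tilted A g \<xi> u)
                \<ge> \<gamma> / 2 * (infdist x (M_set A g \<xi>))\<^sup>2)})"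

definition prox :: "real \<Rightarrow> ('a::euclidean_space \<Rightarrow> real) \<Rightarrow> 'a \<Rightarrow> 'a" where
  "prox \<tau> g z = arg_min (\<lambda>y. g y + 1 / (2 * \<tau>) * (norm (y - z))\<^sup>2) (\<lambda>_. True)"

definition prox_grad_update ::
  "real \<Rightarrow> real^'d^'n \<Rightarrow> (real^'n \<Rightarrow> real) \<Rightarrow> (real^'d \<Rightarrow> real) \<Rightarrow> real^'d \<Rightarrow> real^'d" where
  "prox_grad_update L A f g x =
     prox (1 / L) g (x - (1 / L) *\<^sub>R (transpose A *v grad f (A *v x)))"

definition prox_grad_map ::
  "real \<Rightarrow> real^'d^'n \<Rightarrow> (real^'n \<Rightarrow> real) \<Rightarrow> (real^'d \<Rightarrow> real) \<Rightarrow> real^'d \<Rightarrow> real^'d" where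
  "prox_grad_map L A f g x = L *\<^sub>R (x - prox_grad_update L A f g x)"

definition restricted_prox_error_bound ::
  "(real^'d) set \<Rightarrow> real \<Rightarrow> real^'d^'n \<Rightarrow> (real^'n \<Rightarrow> real) \<Rightarrow> (real^'d \<Rightarrow> real) \<Rightarrow> real \<Rightarrow> bool" where
  "restricted_prox_error_bound K L A f g \<mu> \<longleftrightarrow>
     \<mu> > 0 \<and> (\<forall>x\<in>K. infdist x (opt_set A f g) \<le> \<mu> * norm (prox_grad_map L A f g x))"

end

theory Submission
  imports Defs
begin

text \<open>
  Let \<open>z\<close> be the proximal gradient update of \<open>x\<close>, \<open>G\<close> the proximal gradient mapping at \<open>x\<close>,
  \<open>a = \<parallel>A z - y\<^sup>*\<parallel>\<close>, \<open>D = dist (z, X\<^sup>*)\<close> and \<open>m = dist (z, M)\<close>. The optimality condition of the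
  proximal step gives a subgradient of \<open>F\<close> at \<open>z\<close> of norm at most \<open>2 \<parallel>G\<parallel>\<close>; together with strong
  convexity this yields \<open>\<alpha> a\<^sup>2 \<le> 2 \<parallel>G\<parallel> D\<close>. The same condition gives a subgradient at \<open>z\<close> of the
  tilted function of norm at most \<open>2 \<parallel>G\<parallel> + L a\<close>, because the gradients of \<open>f \<circ> A\<close> at \<open>z\<close> and at an
  optimal point differ by at most \<open>L a\<close>: cocoercivity for \<open>f \<circ> A\<close> bounds the squared difference by
  \<open>2 L\<close> times the Bregman distance, and that is at most \<open>L a\<^sup>2 / 2\<close> since \<open>f\<close> itself is \<open>L\<close>-smooth.
  Firm convexity then gives \<open>m \<le> (2 / \<gamma>) (2 \<parallel>G\<parallel> + L a)\<close>. Inserting both into the Hoffman bound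
  \<open>D \<le> H (a + \<parallel>B\<parallel> m)\<close> leaves a quadratic inequality for \<open>\<surd>D\<close>.

  Hoffman's lemma is needed for \<open>H\<close> to be an infimum over a nonempty set. If \<open>p\<close> is the projection of
  \<open>x\<close> onto the polyhedron, then \<open>x - p\<close> lies in the cone of the constraints active at \<open>p\<close>, and its
  conic coefficients can be chosen of size \<open>O(\<parallel>x - p\<parallel>)\<close> because the convex hull of \<open>0\<close> and the
  generators is a polyhedron, so it contains a neighbourhood of \<open>0\<close> within the cone.
\<close>

section \<open>Hoffman's lemma for finite systems of linear inequalities\<close>

text \<open>Rescaling \<open>v\<close> to a fixed small norm \<open>r\<close> puts it into
  \<open>convex hull (insert 0 S)\<close>, where weights sum to 1; scaling back costs the factor
  \<open>norm v / r\<close>.\<close>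

lemma convex_cone_hull_bounded_coeffs:
  fixes S :: "'a::euclidean_space set"
  assumes "finite S"
  shows "\<exists>C\<ge>0. \<forall>v\<in>convex_cone hull S.
    \<exists>u. (\<forall>a\<in>S. 0 \<le> u a) \<and> sum u S \<le> C * norm v \<and> (\<Sum>a\<in>S. u a *\<^sub>R a) = v"
proof -
  let ?P = "convex hull (insert 0 S)"
  obtain F where "finite F \<and> ?P = \<Inter>F \<and> (\<forall>h\<in>F. \<exists>a b. a \<noteq> 0 \<and> h = {x. a \<bullet> x \<le> b})"
    using polyhedron_convex_hull[OF finite.insertI[OF assms, of 0]] unfolding polyhedron_def by (rule exE)
  then have F: "finite F" "?P = \<Inter>F" "\<forall>h\<in>F. \<exists>a b. a \<noteq> 0 \<and> h = {x. a \<bullet> x \<le> b}"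
    by blast+
  have *: "\<forall>h\<in>F. \<exists>e>0. \<forall>v\<in>convex_cone hull S. norm v \<le> e \<longrightarrow> v \<in> h"
  proof
    fix h assume hF: "h \<in> F"
    obtain a b where ab: "a \<noteq> 0" "h = {x. a \<bullet> x \<le> b}" using bspec[OF F(3) hF] by (elim exE conjE)
    have sub: "insert 0 S \<subseteq> h"
      using Inter_lower[OF hF] hull_subset[of "insert 0 S" convex] unfolding F(2) by (rule order_trans[rotated])
    then have b0: "b \<ge> 0" using ab by auto
    show "\<exists>e>0. \<forall>v\<in>convex_cone hull S. norm v \<le> e \<longrightarrow> v \<in> h"
    \<comment> \<open>A halfspace with the origin on its boundary is itself a cone and so contains
      the whole hull; one with \<open>b > 0\<close> contains a ball around the origin.\<close>
    proof (cases "b = 0")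
      case True
      then have "convex_cone h"
        unfolding convex_cone_iff ab by (auto simp: inner_add_right mult_nonneg_nonpos)
      then have "convex_cone hull S \<subseteq> h"
        using sub by (intro hull_minimal) auto
      then show ?thesis by (intro exI[of _ 1]) auto
    next
      case False
      show ?thesis
      proof (intro exI[of _ "b / norm a"] conjI ballI impI)
        show "b / norm a > 0" using False b0 ab(1) by simp
        fix v :: 'a assume "norm v \<le> b / norm a"
        then have "norm a * norm v \<le> b" using ab(1) by (simp add: field_simps)
        then show "v \<in> h" using norm_cauchy_schwarz[of a v] ab(2) by simp
      qed
    qed
  qed
  obtain e where e: "\<forall>h\<in>F. 0 < e h \<and> (\<forall>v\<in>convex_cone hull S. norm v \<le> e h \<longrightarrow> v \<in> h)"
    using bchoice[OF *] by blast
  define r where "r = Min (insert 1 (e ` F))"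
  have r: "r > 0" "\<And>h. h \<in> F \<Longrightarrow> r \<le> e h"
    unfolding r_def using F(1) e by auto
  have inP: "v \<in> ?P" if "v \<in> convex_cone hull S" "norm v \<le> r" for v
    using that r(2) e unfolding F(2) by (meson InterI order_trans)
  show ?thesis
  proof (intro exI[of _ "1 / r"] conjI ballI)
    show "0 \<le> 1 / r" using r by simp
    fix v assume v: "v \<in> convex_cone hull S"
    show "\<exists>u. (\<forall>a\<in>S. 0 \<le> u a) \<and> sum u S \<le> 1 / r * norm v \<and> (\<Sum>a\<in>S. u a *\<^sub>R a) = v"
    proof (cases "v = 0")
      case True
      then show ?thesis by (intro exI[of _ "\<lambda>_. 0"]) auto
    next
      case False
      have "(r / norm v) *\<^sub>R v \<in> ?P"
        using v r False by (intro inP convex_cone_hull_mul) auto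
      then obtain u where u: "\<forall>a\<in>insert 0 S. 0 \<le> u a" "sum u (insert 0 S) = 1"
        "(\<Sum>a\<in>insert 0 S. u a *\<^sub>R a) = (r / norm v) *\<^sub>R v"
        using assms by (auto simp: convex_hull_finite)
      \<comment> \<open>Passing to \<open>S\<close> drops at most the weight of 0, which adds
        nothing to the combination.\<close>
      have "sum u S \<le> sum u (insert 0 S)"
        using u(1) assms by (intro sum_mono2) auto
      then have le1: "sum u S \<le> 1" using u(2) by simp
      have "(\<Sum>a\<in>S. u a *\<^sub>R a) = (\<Sum>a\<in>insert 0 S. u a *\<^sub>R a)"
        using assms by (intro sum.mono_neutral_left) auto
      then have uS: "(\<Sum>a\<in>S. u a *\<^sub>R a) = (r / norm v) *\<^sub>R v" using u(3) by simp
      have "(\<Sum>a\<in>S. (norm v / r * u a) *\<^sub>R a) = (norm v / r) *\<^sub>R (\<Sum>a\<in>S. u a *\<^sub>R a)"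
        by (simp add: scaleR_sum_right)
      then have "(\<Sum>a\<in>S. (norm v / r * u a) *\<^sub>R a) = v"
        using False r uS by simp
      moreover have "(\<Sum>a\<in>S. norm v / r * u a) \<le> 1 / r * norm v"
      proof -
        have "(\<Sum>a\<in>S. norm v / r * u a) = norm v / r * sum u S"
          by (simp add: sum_distrib_left)
        also have "\<dots> \<le> norm v / r * 1" using le1 r by (intro mult_left_mono) auto
        finally show ?thesis by simp
      qed
      ultimately show ?thesis using u(1) r
        by (intro exI[of _ "\<lambda>a. norm v / r * u a"]) auto
    qed
  qed
qed

text \<open>The residual \<open>v - q\<close> of the projection onto the closed cone is an
  admissible test direction, since \<open>q + a\<close> stays in the cone. Testing with it, and
  comparing \<open>q\<close> with 0, forces the residual to vanish.\<close>

lemma Farkas_convex_cone_hull: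
  fixes S :: "'a::euclidean_space set"
  assumes "finite S" and polar: "\<And>d. (\<And>a. a \<in> S \<Longrightarrow> a \<bullet> d \<le> 0) \<Longrightarrow> v \<bullet> d \<le> 0"
  shows "v \<in> convex_cone hull S"
proof -
  let ?C = "convex_cone hull S"
  have cl: "closed ?C" and cv: "convex ?C" and ne: "?C \<noteq> {}"
    using assms by (auto simp: closed_convex_cone_hull convex_convex_cone_hull convex_cone_hull_nonempty)
  define q where "q = closest_point ?C v"
  have q: "q \<in> ?C" unfolding q_def using cl ne by (rule closest_point_in_set)
  have dot: "(v - q) \<bullet> (y - q) \<le> 0" if "y \<in> ?C" for y
    unfolding q_def using closest_point_dot[OF cv cl that] .
  have "(v - q) \<bullet> a \<le> 0" if "a \<in> S" for a
    using dot[OF convex_cone_hull_add[OF q hull_inc[of a S convex_cone]]] that by simp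
  then have "v \<bullet> (v - q) \<le> 0" by (intro polar) (simp add: inner_commute)
  moreover have "(v - q) \<bullet> q \<ge> 0"
    using dot[OF convex_cone_hull_contains_0] by simp
  ultimately have "(v - q) \<bullet> (v - q) \<le> 0"
    by (simp add: inner_diff_right[of "v - q"] inner_commute[of v])
  then have "v - q = 0" using inner_ge_zero[of "v - q"] inner_eq_zero_iff by (metis order_antisym)
  then show ?thesis using q by simp
qed

text \<open>Writing \<open>x - p\<close> as a combination of active normals, each of which has inner
  product at most \<open>R\<close> with \<open>x - p\<close>, bounds its squared norm by
  \<open>R\<close> times the sum of the coefficients, hence by a multiple of
  \<open>R * norm (x - p)\<close>.\<close>

lemma Hoffman_bound:
  fixes I :: "('a::euclidean_space \<times> real) set"
  assumes "finite I" and ne: "{x. \<forall>(a, b)\<in>I. a \<bullet> x \<le> b} \<noteq> {}"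
  shows "\<exists>C\<ge>0. \<forall>x R. 0 \<le> R \<longrightarrow> (\<forall>(a, b)\<in>I. a \<bullet> x \<le> b + R) \<longrightarrow>
    infdist x {x. \<forall>(a, b)\<in>I. a \<bullet> x \<le> b} \<le> C * R"
proof -
  let ?X = "{x. \<forall>(a, b)\<in>I. a \<bullet> x \<le> b}"
  have X_eq: "?X = (\<Inter>(a, b)\<in>I. {x. a \<bullet> x \<le> b})" by auto
  have cl: "closed ?X"
    unfolding X_eq by (auto intro!: closed_INT closed_halfspace_le)
  have cv: "convex ?X"
    unfolding X_eq by (auto intro!: convex_INT convex_halfspace_le)
  \<comment> \<open>The active set depends on \<open>x\<close>, but there are only finitely many
    candidates; summing their constants gives one bound for all \<open>x\<close>.\<close>
  let ?\<S> = "Pow (fst ` I)"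
  have *: "\<forall>S\<in>?\<S>. \<exists>C\<ge>0. \<forall>v\<in>convex_cone hull S.
    \<exists>u. (\<forall>a\<in>S. 0 \<le> u a) \<and> sum u S \<le> C * norm v \<and> (\<Sum>a\<in>S. u a *\<^sub>R a) = v"
    using assms(1) by (intro ballI convex_cone_hull_bounded_coeffs) (auto intro: finite_subset)
  obtain C where C: "\<forall>S\<in>?\<S>. 0 \<le> C S \<and> (\<forall>v\<in>convex_cone hull S.
    \<exists>u. (\<forall>a\<in>S. 0 \<le> u a) \<and> sum u S \<le> C S * norm v \<and> (\<Sum>a\<in>S. u a *\<^sub>R a) = v)"
    using bchoice[OF *] by blast
  have C0: "C S \<ge> 0" if "S \<in> ?\<S>" for S using C that by blast
  have "infdist x ?X \<le> sum C ?\<S> * R" if R: "0 \<le> R" "\<forall>(a, b)\<in>I. a \<bullet> x \<le> b + R" for x R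
  proof -
    define p where "p = closest_point ?X x"
    have p: "p \<in> ?X" unfolding p_def using cl ne by (rule closest_point_in_set)
    have dot: "(x - p) \<bullet> (y - p) \<le> 0" if "y \<in> ?X" for y
      unfolding p_def using closest_point_dot[OF cv cl that] .
    define S where "S = fst ` {(a, b)\<in>I. a \<bullet> p = b}"
    have S: "S \<in> ?\<S>" unfolding S_def by auto
    have "x - p \<in> convex_cone hull S"
    proof (rule Farkas_convex_cone_hull)
      show "finite S" using S assms(1) by (auto intro: finite_subset)
      fix d assume d: "\<And>a. a \<in> S \<Longrightarrow> a \<bullet> d \<le> 0"
      \<comment> \<open>Short steps along \<open>d\<close> stay feasible: active constraints do not
        increase, inactive ones have slack. The projection inequality at such a point then gives the
        sign of \<open>(x - p) \<bullet> d\<close>.\<close>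
      have *: "\<forall>i\<in>I. \<exists>t>0. \<forall>s. 0 < s \<and> s \<le> t \<longrightarrow> fst i \<bullet> (p + s *\<^sub>R d) \<le> snd i"
      proof
        fix i assume i: "i \<in> I"
        obtain a b where ab: "i = (a, b)" by force
        show "\<exists>t>0. \<forall>s. 0 < s \<and> s \<le> t \<longrightarrow> fst i \<bullet> (p + s *\<^sub>R d) \<le> snd i"
        proof (cases "a \<bullet> p = b")
          case True
          then have "a \<in> S" unfolding S_def using i ab by force
          then show ?thesis using d[of a] True ab
            by (intro exI[of _ 1]) (auto simp: inner_add_right mult_nonneg_nonpos)
        next
          case False
          have lt: "a \<bullet> p < b" using False p i ab by force
          show ?thesis
          proof (intro exI[of _ "(b - a \<bullet> p) / (\<bar>a \<bullet> d\<bar> + 1)"] conjI allI impI)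
            show "(b - a \<bullet> p) / (\<bar>a \<bullet> d\<bar> + 1) > 0" using lt by simp
            fix s assume s: "0 < s \<and> s \<le> (b - a \<bullet> p) / (\<bar>a \<bullet> d\<bar> + 1)"
            have "s * (a \<bullet> d) \<le> s * (\<bar>a \<bullet> d\<bar> + 1)" using s by (intro mult_left_mono) auto
            also have "\<dots> \<le> b - a \<bullet> p" using s by (simp add: field_simps)
            finally show "fst i \<bullet> (p + s *\<^sub>R d) \<le> snd i"
              using ab by (simp add: inner_add_right)
          qed
        qed
      qed
      obtain t where t: "\<forall>i\<in>I. 0 < t i \<and>
          (\<forall>s. 0 < s \<and> s \<le> t i \<longrightarrow> fst i \<bullet> (p + s *\<^sub>R d) \<le> snd i)"
        using bchoice[OF *] by blast
      define s where "s = Min (insert 1 (t ` I))"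
      have s: "s > 0" "\<And>i. i \<in> I \<Longrightarrow> s \<le> t i"
        unfolding s_def using assms(1) t by auto
      have "p + s *\<^sub>R d \<in> ?X" using t s by auto
      from dot[OF this] show "(x - p) \<bullet> d \<le> 0" using s by (simp add: mult_le_0_iff)
    qed
    then obtain u where u: "\<forall>a\<in>S. 0 \<le> u a" "sum u S \<le> C S * norm (x - p)"
      "(\<Sum>a\<in>S. u a *\<^sub>R a) = x - p"
      using C S by blast
    have "(norm (x - p))\<^sup>2 = (\<Sum>a\<in>S. u a *\<^sub>R a) \<bullet> (x - p)"
      by (simp add: u(3) power2_norm_eq_inner)
    also have "\<dots> = (\<Sum>a\<in>S. u a * (a \<bullet> (x - p)))" by (simp add: inner_sum_left)
    also have "\<dots> \<le> (\<Sum>a\<in>S. u a * R)"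
    proof (intro sum_mono mult_left_mono)
      fix a assume a: "a \<in> S"
      show "0 \<le> u a" using u(1) a by blast
      from a obtain b where "(a, b) \<in> I" "a \<bullet> p = b" unfolding S_def by auto
      then show "a \<bullet> (x - p) \<le> R" using R(2) by (force simp: inner_diff_right)
    qed
    also have "\<dots> = sum u S * R" by (simp add: sum_distrib_right)
    also have "\<dots> \<le> (C S * norm (x - p)) * R" using u(2) R(1) by (rule mult_right_mono)
    finally have "norm (x - p) * norm (x - p) \<le> norm (x - p) * (C S * R)"
      by (simp add: power2_eq_square ac_simps)
    then have "norm (x - p) \<le> C S * R"
      using C0[OF S] R(1) by (cases "x = p") auto
    also have "\<dots> \<le> sum C ?\<S> * R"
      using S C0 assms(1) R(1) by (intro mult_right_mono member_le_sum) auto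
    finally show ?thesis using infdist_le[OF p, of x] by (simp add: dist_norm)
  qed
  moreover have "sum C ?\<S> \<ge> 0" using C0 by (rule sum_nonneg)
  ultimately show ?thesis by blast
qed

section \<open>Gradients, smoothness and strong convexity\<close>

text \<open>Serves the first-order arguments below: an inequality along a segment, divided by the
  step length \<open>t\<close>, keeps an error \<open>t * c\<close> that vanishes in the
  limit.\<close>

lemma le_of_le_add_small:
  fixes x y c :: real
  assumes "\<And>t. 0 < t \<Longrightarrow> t \<le> 1 \<Longrightarrow> x \<le> y + t * c"
  shows "x \<le> y"
proof (rule tendsto_lowerbound)
  show "((\<lambda>t. y + t * c) \<longlongrightarrow> y) (at_right 0)" by (auto intro!: tendsto_eq_intros)
  show "\<forall>\<^sub>F t in at_right 0. x \<le> y + t * c"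
    unfolding eventually_at_right[OF zero_less_one] using assms by (intro exI[of _ 1]) auto
qed simp

lemma GDERIV_unique: "GDERIV h x :> D \<Longrightarrow> GDERIV h x :> D' \<Longrightarrow> D = D'"
  for h :: "'a::euclidean_space \<Rightarrow> real"
proof -
  assume "GDERIV h x :> D" "GDERIV h x :> D'"
  then have "(\<lambda>u. u \<bullet> D) = (\<lambda>u. u \<bullet> D')"
    unfolding gderiv_def by (rule has_derivative_unique)
  then show "D = D'" by (metis vector_eq_ldot)
qed

lemma grad_eq: "GDERIV h x :> D \<Longrightarrow> grad h x = D"
  unfolding grad_def using GDERIV_unique by blast

lemma inner_transpose_matrix: "(transpose A *v y) \<bullet> x = y \<bullet> (A *v x)"
  for A :: "real^'d^'n"
  by (simp add: dot_lmul_matrix)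

lemma GDERIV_matrix_compose:
  fixes A :: "real^'d^'n"
  assumes "GDERIV f (A *v x) :> D"
  shows "GDERIV (\<lambda>x. f (A *v x)) x :> transpose A *v D"
proof -
  have "((*v) A has_derivative (*v) A) (at x)"
    by (simp add: bounded_linear_imp_has_derivative)
  from has_derivative_compose[OF this assms[unfolded gderiv_def]] show ?thesis
    unfolding gderiv_def
    by (simp only: inner_transpose_matrix inner_commute[of _ "transpose A *v D"] inner_commute[of _ D])
qed

text \<open>\<open>\<phi>\<close> is \<open>h\<close> minus its quadratic model along the segment,
  up to a constant; by Cauchy-Schwarz and the Lipschitz bound its derivative is nonpositive.\<close>

lemma descent_lemma:
  fixes h :: "'a::euclidean_space \<Rightarrow> real"
  assumes D: "\<And>x. GDERIV h x :> G x" and Lip: "\<And>x y. norm (G x - G y) \<le> L * norm (x - y)"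
  shows "h y \<le> h x + G x \<bullet> (y - x) + L / 2 * (norm (y - x))\<^sup>2"
proof -
  let ?d = "y - x"
  define \<phi> where "\<phi> t = h (x + t *\<^sub>R ?d) - t * (G x \<bullet> ?d) - L / 2 * t\<^sup>2 * (norm ?d)\<^sup>2" for t
  have "\<phi> 1 \<le> \<phi> 0"
  proof (rule DERIV_nonpos_imp_nonincreasing[of 0 1 \<phi>])
    fix t :: real assume t: "0 \<le> t" "t \<le> 1"
    have "((\<lambda>t. x + t *\<^sub>R ?d) has_derivative (\<lambda>s. s *\<^sub>R ?d)) (at t)"
      using has_derivative_add[OF has_derivative_const
          has_derivative_scaleR_left[OF has_derivative_ident]] by simp
    from has_derivative_compose[OF this D[unfolded gderiv_def]]
    have "((\<lambda>t. h (x + t *\<^sub>R ?d)) has_real_derivative (G (x + t *\<^sub>R ?d) \<bullet> ?d)) (at t)"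
      by (simp add: has_field_derivative_def inner_commute mult_commute_abs)
    then have "(\<phi> has_real_derivative
        G (x + t *\<^sub>R ?d) \<bullet> ?d - G x \<bullet> ?d - L * t * (norm ?d)\<^sup>2) (at t)"
      unfolding \<phi>_def[abs_def] by (auto intro!: derivative_eq_intros)
    moreover have "G (x + t *\<^sub>R ?d) \<bullet> ?d - G x \<bullet> ?d - L * t * (norm ?d)\<^sup>2 \<le> 0"
    proof -
      have "(G (x + t *\<^sub>R ?d) - G x) \<bullet> ?d \<le> norm (G (x + t *\<^sub>R ?d) - G x) * norm ?d"
        by (rule norm_cauchy_schwarz)
      also have "\<dots> \<le> (L * norm (t *\<^sub>R ?d)) * norm ?d"
        using Lip[of "x + t *\<^sub>R ?d" x] by (intro mult_right_mono) auto
      finally show ?thesis using t by (simp add: inner_diff_left power2_eq_square)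
    qed
    ultimately show "\<exists>y. (\<phi> has_real_derivative y) (at t) \<and> y \<le> 0" by blast
  qed simp
  then show ?thesis unfolding \<phi>_def by simp
qed

lemma L_smooth_bounds:
  fixes h :: "'a::euclidean_space \<Rightarrow> real"
  assumes "L_smooth L h"
  shows "h y \<le> h x + grad h x \<bullet> (y - x) + L / 2 * (norm (y - x))\<^sup>2"
    and "h y \<ge> h x + grad h x \<bullet> (y - x) - L / 2 * (norm (y - x))\<^sup>2"
    and "norm (grad h x - grad h y) \<le> L * norm (x - y)"
proof -
  have D: "\<And>x. GDERIV h x :> grad h x"
    and Lip: "\<And>x y. norm (grad h x - grad h y) \<le> L * norm (x - y)"
    using assms unfolding L_smooth_def lipschitz_on_def by (auto simp: dist_norm)
  show "norm (grad h x - grad h y) \<le> L * norm (x - y)" by (rule Lip)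
  show "h y \<le> h x + grad h x \<bullet> (y - x) + L / 2 * (norm (y - x))\<^sup>2"
    using D Lip by (rule descent_lemma)
  \<comment> \<open>The lower bound is the descent lemma for \<open>- h\<close>.\<close>
  have "norm (- grad h x - - grad h y) \<le> L * norm (x - y)" for x y
    using Lip[of x y] by (simp add: norm_minus_commute)
  from descent_lemma[OF GDERIV_minus[OF D] this, of y x]
  show "h y \<ge> h x + grad h x \<bullet> (y - x) - L / 2 * (norm (y - x))\<^sup>2" by simp
qed

text \<open>At \<open>x + t *\<^sub>R (y - x)\<close> smoothness bounds \<open>h\<close> from below
  and strong convexity bounds it from above; divide by \<open>t\<close> and let it tend to
  0.\<close>

lemma strongly_convex_grad:
  fixes h :: "'a::euclidean_space \<Rightarrow> real"
  assumes "strongly_convex \<alpha> h" "L_smooth L h"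
  shows "h y \<ge> h x + grad h x \<bullet> (y - x) + \<alpha> / 2 * (norm (y - x))\<^sup>2"
proof -
  let ?n = "(norm (y - x))\<^sup>2"
  have "h x + grad h x \<bullet> (y - x) + \<alpha> / 2 * ?n \<le> h y + t * (L / 2 * ?n + \<alpha> / 2 * ?n)"
    if t: "0 < t" "t \<le> 1" for t
  proof -
    have "h x + grad h x \<bullet> (t *\<^sub>R (y - x)) - L / 2 * (norm (t *\<^sub>R (y - x)))\<^sup>2
      \<le> h (x + t *\<^sub>R (y - x))"
      using L_smooth_bounds(2)[OF assms(2), of x "x + t *\<^sub>R (y - x)"] by simp
    also have "x + t *\<^sub>R (y - x) = t *\<^sub>R y + (1 - t) *\<^sub>R x" by (simp add: algebra_simps)
    also have "h \<dots> \<le> t * h y + (1 - t) * h x - \<alpha> / 2 * t * (1 - t) * ?n"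
      using assms(1) t unfolding strongly_convex_def by auto
    finally have "t * (h x + grad h x \<bullet> (y - x) + \<alpha> / 2 * ?n)
        \<le> t * (h y + t * (L / 2 * ?n + \<alpha> / 2 * ?n))"
      using t by (simp add: algebra_simps diff_divide_distrib power2_eq_square flip: scaleR_diff_right)
    then show ?thesis using t by simp
  qed
  then show ?thesis by (rule le_of_le_add_small)
qed

text \<open>Minimising the quadratic upper bound at \<open>z\<close> of the nonnegative function
  \<open>h - h x - grad h x \<bullet> (\<cdot> - x)\<close>.\<close>
lemma grad_diff_le_Bregman:
  fixes h :: "'a::euclidean_space \<Rightarrow> real"
  assumes sm: "L_smooth L h" and cv: "\<And>u. h u \<ge> h x + grad h x \<bullet> (u - x)"
  shows "(norm (grad h z - grad h x))\<^sup>2 \<le> 2 * L * (h z - h x - grad h x \<bullet> (z - x))"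
proof -
  let ?w = "grad h z - grad h x"
  have L: "L > 0" using sm unfolding L_smooth_def by simp
  define u where "u = z - (1 / L) *\<^sub>R ?w"
  have uz: "u - z = - (1 / L) *\<^sub>R ?w" unfolding u_def by simp
  have nrm: "L / 2 * (norm (u - z))\<^sup>2 = (norm ?w)\<^sup>2 / (2 * L)"
    unfolding uz using L by (simp add: power_divide power2_eq_square)
  have ww: "?w \<bullet> (u - z) = - ((norm ?w)\<^sup>2 / L)"
    unfolding uz by (simp add: power2_norm_eq_inner)
  have "h x + grad h x \<bullet> (u - x) \<le> h z + grad h z \<bullet> (u - z) + (norm ?w)\<^sup>2 / (2 * L)"
    using cv[of u] L_smooth_bounds(1)[OF sm, of u z] nrm by linarith
  also have "grad h z \<bullet> (u - z) = grad h x \<bullet> (u - z) + ?w \<bullet> (u - z)"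
    by (simp add: inner_diff_left)
  finally have "(norm ?w)\<^sup>2 / L - (norm ?w)\<^sup>2 / (2 * L) \<le> h z - h x - grad h x \<bullet> (z - x)"
    unfolding ww by (simp add: inner_diff_right)
  moreover have "(norm ?w)\<^sup>2 / L - (norm ?w)\<^sup>2 / (2 * L) = (norm ?w)\<^sup>2 / (2 * L)"
    using L by (simp add: field_simps)
  ultimately show ?thesis using L by (simp add: field_simps)
qed

section \<open>Polyhedral convex functions and the proximal step\<close>

lemma polyhedral_convexD:
  assumes "polyhedral_convex g"
  shows "convex_on UNIV g" and "continuous_on UNIV g" and "\<exists>a b. \<forall>x. a \<bullet> x + b \<le> g x"
proof -
  obtain m :: nat and a b where m: "m \<ge> 1" and g: "\<And>x. g x = Max ((\<lambda>i. a i \<bullet> x + b i) ` {1..m})"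
    using assms unfolding polyhedral_convex_def by blast
  have le: "a i \<bullet> x + b i \<le> g x" if "i \<in> {1..m}" for i x
    unfolding g using that by (intro Max_ge) auto
  show "\<exists>a b. \<forall>x. a \<bullet> x + b \<le> g x" using le[of 1] m by auto
  show cv: "convex_on UNIV g"
  proof (intro convex_onI)
    fix t :: real and x y assume t: "0 < t" "t < 1"
    show "g ((1 - t) *\<^sub>R x + t *\<^sub>R y) \<le> (1 - t) * g x + t * g y"
      unfolding g[of "(1 - t) *\<^sub>R x + t *\<^sub>R y"]
    proof (intro Max.boundedI)
      fix v assume "v \<in> (\<lambda>i. a i \<bullet> ((1 - t) *\<^sub>R x + t *\<^sub>R y) + b i) ` {1..m}"
      then obtain i where i: "i \<in> {1..m}" "v = a i \<bullet> ((1 - t) *\<^sub>R x + t *\<^sub>R y) + b i" by auto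
      have "v = (1 - t) * (a i \<bullet> x + b i) + t * (a i \<bullet> y + b i)"
        unfolding i(2) by (simp add: inner_add_right algebra_simps)
      also have "\<dots> \<le> (1 - t) * g x + t * g y"
        using t le[OF i(1)] by (intro add_mono mult_left_mono) auto
      finally show "v \<le> (1 - t) * g x + t * g y" .
    qed (use m in auto)
  qed simp
  show "continuous_on UNIV g" using convex_on_continuous[OF open_UNIV cv] .
qed

text \<open>\<open>arg_min\<close> is a choice operator, so a minimiser must be shown to exist. One
  exists on a compact ball, outside which the quadratic term outweighs the affine minorant and the
  objective is at least its value at \<open>z\<close>.\<close>

lemma prox_is_minimizer:
  fixes g :: "'a::euclidean_space \<Rightarrow> real"
  assumes "continuous_on UNIV g" and "\<And>x. a \<bullet> x + b \<le> g x" and "\<tau> > 0"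
  shows "g (prox \<tau> g z) + 1 / (2 * \<tau>) * (norm (prox \<tau> g z - z))\<^sup>2
    \<le> g y + 1 / (2 * \<tau>) * (norm (y - z))\<^sup>2"
proof -
  define q where "q y = g y + 1 / (2 * \<tau>) * (norm (y - z))\<^sup>2" for y
  define \<kappa> where "\<kappa> = 1 / (2 * \<tau>)"
  have \<kappa>: "\<kappa> > 0" using assms(3) unfolding \<kappa>_def by simp
  define c where "c = g z - a \<bullet> z - b"
  have c: "c \<ge> 0" using assms(2)[of z] unfolding c_def by simp
  \<comment> \<open>Chosen so that \<open>\<kappa> * n \<ge> norm a + c\<close> for
    \<open>n > r\<close>; the summand 1 gives \<open>n \<ge> 1\<close>, hence
    \<open>c \<le> c * n\<close>.\<close>
  define r where "r = (norm a + c) / \<kappa> + 1"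
  have r: "r \<ge> 1" unfolding r_def using c \<kappa> by simp
  have cont: "continuous_on (cball z r) q"
    unfolding q_def[abs_def] using continuous_on_subset[OF assms(1)]
    by (intro continuous_intros) auto
  have "cball z r \<noteq> {}" using r by simp
  then obtain p where p: "p \<in> cball z r" "\<And>y. y \<in> cball z r \<Longrightarrow> q p \<le> q y"
    using continuous_attains_inf[OF compact_cball _ cont] by blast
  have "q p \<le> q y" for y
  proof (cases "y \<in> cball z r")
    case False
    let ?n = "norm (y - z)"
    have n: "?n > r" using False by (simp add: dist_norm norm_minus_commute)
    have "\<kappa> * ?n \<ge> \<kappa> * r" using n \<kappa> by simp
    moreover have "\<kappa> * r = norm a + c + \<kappa>" unfolding r_def using \<kappa> by (simp add: field_simps)
    ultimately have "c \<le> \<kappa> * ?n - norm a" using \<kappa> by linarith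
    moreover have "c * 1 \<le> c * ?n" using c n r by (intro mult_left_mono) auto
    moreover have "c * ?n \<le> (\<kappa> * ?n - norm a) * ?n"
      using calculation(1) by (rule mult_right_mono) simp
    ultimately have "c \<le> \<kappa> * ?n\<^sup>2 - norm a * ?n"
      by (simp add: algebra_simps power2_eq_square)
    moreover have "a \<bullet> (y - z) \<ge> - (norm a * ?n)"
      using Cauchy_Schwarz_ineq2[of a "y - z"] by simp
    ultimately have "g z \<le> q y"
      using assms(2)[of y] unfolding c_def q_def \<kappa>_def by (simp add: inner_diff_right)
    moreover have "q p \<le> q z" using p(2) r by simp
    ultimately show ?thesis unfolding q_def by simp
  qed (rule p(2))
  then have "is_arg_min q (\<lambda>_. True) p" unfolding is_arg_min_def by (simp add: not_less)
  then have "is_arg_min q (\<lambda>_. True) (arg_min q (\<lambda>_. True))"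
    unfolding arg_min_def by (rule someI)
  then show ?thesis
    unfolding is_arg_min_def prox_def q_def[abs_def] by (simp add: not_less)
qed

text \<open>Comparing the proximal point with points a fraction \<open>t\<close> of the way to
  \<open>u\<close>, then letting \<open>t\<close> tend to 0, gives the optimality condition of the
  proximal problem.\<close>

lemma prox_subgradient:
  fixes g :: "'a::euclidean_space \<Rightarrow> real"
  assumes "polyhedral_convex g" and "\<tau> > 0"
  shows "g u \<ge> g (prox \<tau> g z) + (1 / \<tau>) * ((z - prox \<tau> g z) \<bullet> (u - prox \<tau> g z))"
proof -
  let ?p = "prox \<tau> g z"
  obtain a b where ab: "\<And>x. a \<bullet> x + b \<le> g x" using polyhedral_convexD(3)[OF assms(1)] by blast
  define \<kappa> where "\<kappa> = 1 / (2 * \<tau>)"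
  note min = prox_is_minimizer[OF polyhedral_convexD(2)[OF assms(1)] ab assms(2), of z, folded \<kappa>_def]
  have "g ?p + 2 * \<kappa> * ((z - ?p) \<bullet> (u - ?p)) \<le> g u + t * (\<kappa> * (norm (u - ?p))\<^sup>2)"
    if t: "0 < t" "t \<le> 1" for t
  proof -
    let ?y = "(1 - t) *\<^sub>R ?p + t *\<^sub>R u"
    have yz: "?y - z = (?p - z) + t *\<^sub>R (u - ?p)" by (simp add: algebra_simps)
    have "g ?y \<le> (1 - t) * g ?p + t * g u"
      using convex_onD[OF polyhedral_convexD(1)[OF assms(1)], of t ?p u] t by simp
    moreover have "(norm (?y - z))\<^sup>2
        = (norm (?p - z))\<^sup>2 + 2 * t * ((?p - z) \<bullet> (u - ?p)) + t\<^sup>2 * (norm (u - ?p))\<^sup>2"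
      unfolding yz power2_norm_eq_inner
      by (simp add: inner_add_left inner_add_right inner_commute power2_eq_square)
    ultimately have "g ?p + \<kappa> * (norm (?p - z))\<^sup>2 \<le> (1 - t) * g ?p + t * g u +
        \<kappa> * ((norm (?p - z))\<^sup>2 + 2 * t * ((?p - z) \<bullet> (u - ?p)) + t\<^sup>2 * (norm (u - ?p))\<^sup>2)"
      using min[of ?y] by simp
    moreover have "(?p - z) \<bullet> (u - ?p) = - ((z - ?p) \<bullet> (u - ?p))"
      by (simp add: inner_diff_left)
    ultimately have "t * (g ?p + 2 * \<kappa> * ((z - ?p) \<bullet> (u - ?p)))
        \<le> t * (g u + t * (\<kappa> * (norm (u - ?p))\<^sup>2))"
      by (simp add: algebra_simps power2_eq_square)
    then show ?thesis using t by simp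
  qed
  from le_of_le_add_small[OF this] show ?thesis unfolding \<kappa>_def by simp
qed

section \<open>The optimal set and the tilted problem\<close>

lemma in_argmin_set: "x \<in> argmin_set h \<longleftrightarrow> (\<forall>u. h x \<le> h u)"
  unfolding argmin_set_def is_arg_min_def by (simp add: not_less)

lemma tilted_eq: "tilted A g \<xi> u = g u + \<xi> \<bullet> (A *v u)"
  unfolding tilted_def inner_transpose_matrix ..

text \<open>Strong convexity of \<open>f\<close> linearised at \<open>A *v x\<close>: the linear
  term is exactly the tilt added to \<open>g\<close>.\<close>

lemma composite_ge_tilted:
  assumes "strongly_convex \<alpha> f" "L_smooth L f"
  shows "composite A f g u - composite A f g x \<ge> \<alpha> / 2 * (norm (A *v u - A *v x))\<^sup>2
    + (tilted A g (grad f (A *v x)) u - tilted A g (grad f (A *v x)) x)"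
  using strongly_convex_grad[OF assms, of "A *v x" "A *v u"]
  unfolding composite_def tilted_eq by (simp add: inner_diff_right)

text \<open>First-order optimality of \<open>x\<close> along the segment to \<open>u\<close>, with
  \<open>f\<close> replaced by its linearisation up to an error of order
  \<open>t\<^sup>2\<close>.\<close>

lemma opt_set_subset_M_set:
  assumes "L_smooth L f" "polyhedral_convex g" "x \<in> opt_set A f g"
  shows "x \<in> M_set A g (grad f (A *v x))"
  unfolding M_set_def in_argmin_set tilted_eq
proof
  fix u
  let ?\<xi> = "grad f (A *v x)" and ?n = "(norm (A *v u - A *v x))\<^sup>2"
  have "g x + ?\<xi> \<bullet> (A *v x) \<le> g u + ?\<xi> \<bullet> (A *v u) + t * (L / 2 * ?n)"
    if t: "0 < t" "t \<le> 1" for t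
  proof -
    let ?y = "(1 - t) *\<^sub>R x + t *\<^sub>R u"
    have Ay: "A *v ?y - A *v x = t *\<^sub>R (A *v u - A *v x)"
      by (simp add: matrix_vector_right_distrib matrix_vector_mult_scaleR algebra_simps)
    have "f (A *v ?y) \<le> f (A *v x) + t * (?\<xi> \<bullet> (A *v u - A *v x)) + L / 2 * t\<^sup>2 * ?n"
      using L_smooth_bounds(1)[OF assms(1), of "A *v ?y" "A *v x"] unfolding Ay
      by (simp add: power_mult_distrib)
    moreover have "g ?y \<le> (1 - t) * g x + t * g u"
      using convex_onD[OF polyhedral_convexD(1)[OF assms(2)], of t x u] t by simp
    moreover have "f (A *v x) + g x \<le> f (A *v ?y) + g ?y"
      using assms(3) unfolding opt_set_def in_argmin_set composite_def by blast
    ultimately have "t * (g x + ?\<xi> \<bullet> (A *v x))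
        \<le> t * (g u + ?\<xi> \<bullet> (A *v u) + t * (L / 2 * ?n))"
      by (simp add: algebra_simps inner_diff_right power2_eq_square)
    then show ?thesis using t by simp
  qed
  then show "g x + ?\<xi> \<bullet> (A *v x) \<le> g u + ?\<xi> \<bullet> (A *v u)" by (rule le_of_le_add_small)
qed

text \<open>Between two optimal points the composite gap is at most 0 and the tilted gap at least 0,
  so the quadratic term of \<open>composite_ge_tilted\<close> vanishes. This makes the
  \<open>THE\<close> in \<open>opt_image\<close> well defined.\<close>

lemma opt_image_eq:
  assumes "\<alpha> > 0" "strongly_convex \<alpha> f" "L_smooth L f" "polyhedral_convex g"
    and x: "x \<in> opt_set A f g"
  shows "A *v x = opt_image A f g"
proof -
  have same: "A *v u = A *v x" if u: "u \<in> opt_set A f g" for u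
  proof -
    have "composite A f g u \<le> composite A f g x"
      using u unfolding opt_set_def in_argmin_set by blast
    moreover have "tilted A g (grad f (A *v x)) x \<le> tilted A g (grad f (A *v x)) u"
      using opt_set_subset_M_set[OF assms(3,4) x] unfolding M_set_def in_argmin_set by blast
    ultimately have "\<alpha> / 2 * (norm (A *v u - A *v x))\<^sup>2 \<le> 0"
      using composite_ge_tilted[OF assms(2,3), of A u x g] by linarith
    then show ?thesis using assms(1) by (simp add: mult_le_0_iff)
  qed
  show ?thesis unfolding opt_image_def
  proof (rule the_equality[symmetric])
    show "\<forall>u\<in>opt_set A f g. A *v u = A *v x" using same by blast
    show "y = A *v x" if "\<forall>u\<in>opt_set A f g. A *v u = y" for y using that x by simp
  qed
qed

text \<open>For the inclusion from right to left: where \<open>A *v x\<close> is fixed, the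
  composite and the tilted function differ by a constant.\<close>

lemma opt_set_eq:
  assumes "\<alpha> > 0" "strongly_convex \<alpha> f" "L_smooth L f" "polyhedral_convex g"
    and ne: "opt_set A f g \<noteq> {}"
  shows "opt_set A f g
    = {x. A *v x = opt_image A f g} \<inter> M_set A g (grad f (opt_image A f g))" (is "_ = ?R")
proof
  note im = opt_image_eq[OF assms(1-4)]
  show "opt_set A f g \<subseteq> ?R"
  proof
    fix x assume "x \<in> opt_set A f g"
    then show "x \<in> ?R" using im opt_set_subset_M_set[OF assms(3,4)] by fastforce
  qed
  obtain x0 where x0: "x0 \<in> opt_set A f g" using ne by blast
  show "?R \<subseteq> opt_set A f g"
  proof
    fix x assume x: "x \<in> ?R"
    then have "tilted A g (grad f (opt_image A f g)) x \<le> tilted A g (grad f (opt_image A f g)) x0"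
      by (simp add: M_set_def in_argmin_set)
    then have "composite A f g x \<le> composite A f g x0"
      using x im[OF x0] unfolding tilted_eq composite_def by simp
    then show "x \<in> opt_set A f g"
      using x0 unfolding opt_set_def in_argmin_set by (meson order_trans)
  qed
qed

text \<open>The subgradient at the new point involves the gradient of the smooth part at the old
  point \<open>x\<close>; correcting this mismatch later costs a second
  \<open>norm G\<close>.\<close>

lemma prox_grad_update_subgradient:
  assumes "L > 0" "polyhedral_convex g"
  shows "g u \<ge> g (prox_grad_update L A f g x)
    + (prox_grad_map L A f g x - transpose A *v grad f (A *v x)) \<bullet> (u - prox_grad_update L A f g x)"
proof -
  let ?z = "prox_grad_update L A f g x" and ?\<nu> = "transpose A *v grad f (A *v x)"
  have "g u \<ge> g ?z + 1 / (1 / L) * ((x - (1 / L) *\<^sub>R ?\<nu> - ?z) \<bullet> (u - ?z))"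
    using prox_subgradient[OF assms(2), of "1 / L" "x - (1 / L) *\<^sub>R ?\<nu>" u] assms(1)
    unfolding prox_grad_update_def by simp
  moreover have "1 / (1 / L) * ((x - (1 / L) *\<^sub>R ?\<nu> - ?z) \<bullet> (u - ?z))
    = (L *\<^sub>R (x - (1 / L) *\<^sub>R ?\<nu> - ?z)) \<bullet> (u - ?z)" by simp
  moreover have "L *\<^sub>R (x - (1 / L) *\<^sub>R ?\<nu> - ?z) = prox_grad_map L A f g x - ?\<nu>"
    unfolding prox_grad_map_def using assms(1)
    by (simp add: algebra_simps del: transpose_matrix_vector)
  ultimately show ?thesis by (simp only:)
qed

section \<open>The restricted Hoffman and firm convexity constants\<close>

text \<open>Each equation becomes two opposite inequalities, and every single row violation is at
  most the sum of the two residual norms, which serves as \<open>R\<close>.\<close>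

lemma Hoffman_bound_matrix:
  fixes A :: "real^'d^'n" and B :: "real^'d^'m"
  assumes "{x. A *v x = y \<and> B *v x \<le> c} \<noteq> {}"
  shows "\<exists>C\<ge>0. \<forall>x. infdist x {x. A *v x = y \<and> B *v x \<le> c}
    \<le> C * (norm (A *v x - y) + norm (pos_part (B *v x - c)))"
proof -
  define I where "I = (range (\<lambda>i. (A $ i, y $ i)) \<union> range (\<lambda>i. (- (A $ i), - (y $ i))))
    \<union> range (\<lambda>i. (B $ i, c $ i))"
  have fin: "finite I" unfolding I_def by simp
  have I: "(\<forall>(a, b)\<in>I. a \<bullet> x \<le> b + R) \<longleftrightarrow>
    (\<forall>i. \<bar>(A *v x - y) $ i\<bar> \<le> R) \<and> (\<forall>i. (B *v x - c) $ i \<le> R)" for x R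
  proof -
    have "(\<forall>(a, b)\<in>I. a \<bullet> x \<le> b + R) \<longleftrightarrow> (\<forall>i. A $ i \<bullet> x \<le> y $ i + R)
        \<and> (\<forall>i. - (A $ i) \<bullet> x \<le> - (y $ i) + R) \<and> (\<forall>i. B $ i \<bullet> x \<le> c $ i + R)"
      unfolding I_def by (simp add: ball_Un)
    moreover have "\<bar>(A *v x - y) $ i\<bar> \<le> R \<longleftrightarrow> A $ i \<bullet> x \<le> y $ i + R \<and> - (A $ i) \<bullet> x \<le> - (y $ i) + R" for i
      by (auto simp: matrix_vector_mul_component)
    moreover have "(B *v x - c) $ i \<le> R \<longleftrightarrow> B $ i \<bullet> x \<le> c $ i + R" for i
      by (auto simp: matrix_vector_mul_component)
    ultimately show ?thesis by blast
  qed
  have X: "{x. \<forall>(a, b)\<in>I. a \<bullet> x \<le> b} = {x. A *v x = y \<and> B *v x \<le> c}"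
    using I[of _ 0] by (auto simp: vec_eq_iff less_eq_vec_def)
  obtain C where C: "C \<ge> 0" "\<And>x R. 0 \<le> R \<Longrightarrow> \<forall>(a, b)\<in>I. a \<bullet> x \<le> b + R \<Longrightarrow>
      infdist x {x. A *v x = y \<and> B *v x \<le> c} \<le> C * R"
    using Hoffman_bound[OF fin] assms unfolding X by blast
  have "infdist x {x. A *v x = y \<and> B *v x \<le> c}
      \<le> C * (norm (A *v x - y) + norm (pos_part (B *v x - c)))" for x
  proof (rule C(2))
    let ?R = "norm (A *v x - y) + norm (pos_part (B *v x - c))"
    have "\<bar>(A *v x - y) $ i\<bar> \<le> ?R" for i
      using component_le_norm_cart[of "A *v x - y" i] norm_ge_zero[of "pos_part (B *v x - c)"]
      by linarith
    moreover have "(B *v x - c) $ i \<le> ?R" for i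
    proof -
      have "(B *v x - c) $ i \<le> \<bar>pos_part (B *v x - c) $ i\<bar>" unfolding pos_part_def by simp
      then show ?thesis
        using component_le_norm_cart[of "pos_part (B *v x - c)" i] norm_ge_zero[of "A *v x - y"]
        by linarith
    qed
    ultimately show "\<forall>(a, b)\<in>I. a \<bullet> x \<le> b + ?R" unfolding I by blast
  qed simp
  then show ?thesis using C(1) by blast
qed

text \<open>The infimum is attained: where the residual is positive, distance over residual is a
  lower bound of all admissible constants; where it is 0, any admissible constant forces distance
  0.\<close>

lemma hoffman_const_bound:
  assumes X: "X = {x. A *v x = y \<and> B *v x \<le> c}" "X \<noteq> {}"
  shows "hoffman_const K X A y B c \<ge> 0"
    and "x \<in> K \<Longrightarrow> infdist x X
      \<le> hoffman_const K X A y B c * (norm (A *v x - y) + norm (pos_part (B *v x - c)))"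
proof -
  let ?s = "\<lambda>x. norm (A *v x - y) + norm (pos_part (B *v x - c))"
  define \<H> where "\<H> = {H. 0 \<le> H \<and> (\<forall>x\<in>K. infdist x X \<le> H * ?s x)}"
  have H: "hoffman_const K X A y B c = Inf \<H>" unfolding hoffman_const_def \<H>_def ..
  have ne: "\<H> \<noteq> {}" using Hoffman_bound_matrix[of A y B c] X unfolding \<H>_def by blast
  show "hoffman_const K X A y B c \<ge> 0"
    unfolding H using ne by (rule cInf_greatest) (simp add: \<H>_def)
  show "infdist x X \<le> hoffman_const K X A y B c * ?s x" if "x \<in> K"
  proof (cases "?s x = 0")
    case True
    obtain h where "h \<in> \<H>" using ne by blast
    then have "infdist x X \<le> h * ?s x" using that unfolding \<H>_def by blast
    then show ?thesis unfolding True by simp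
  next
    case False
    then have pos: "?s x > 0" by (metis add_nonneg_nonneg norm_ge_zero order_le_less)
    have "infdist x X / ?s x \<le> Inf \<H>"
      using ne
    proof (rule cInf_greatest)
      fix h assume "h \<in> \<H>"
      then have "infdist x X \<le> h * ?s x" using that unfolding \<H>_def by blast
      then show "infdist x X / ?s x \<le> h" using pos by (simp add: pos_divide_le_eq)
    qed
    then show ?thesis unfolding H using pos by (simp add: pos_divide_le_eq)
  qed
qed

text \<open>Each \<open>s < r\<close> lies below an admissible constant and the inequality is
  monotone in the constant; \<open>r\<close> itself follows in the limit. Stating it for all
  \<open>r\<close> up to the supremum covers finite and infinite values alike.\<close>

lemma firm_const_bound:
  assumes "ereal r \<le> firm_const K A g \<xi>" "0 < r" "x \<in> K"
  shows "r / 2 * (infdist x (M_set A g \<xi>))\<^sup>2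
    \<le> tilted A g \<xi> x - (INF u\<in>M_set A g \<xi>. tilted A g \<xi> u)"
proof -
  let ?d = "(infdist x (M_set A g \<xi>))\<^sup>2"
    and ?G = "tilted A g \<xi> x - (INF u\<in>M_set A g \<xi>. tilted A g \<xi> u)"
  define \<Gamma> where "\<Gamma> = {\<gamma>. \<gamma> > 0 \<and> (\<forall>x\<in>K. tilted A g \<xi> x - (INF u\<in>M_set A g \<xi>. tilted A g \<xi> u)
     \<ge> \<gamma> / 2 * (infdist x (M_set A g \<xi>))\<^sup>2)}"
  have sup: "firm_const K A g \<xi> = Sup (ereal ` \<Gamma>)" unfolding firm_const_def \<Gamma>_def ..
  have \<Gamma>: "\<gamma> / 2 * ?d \<le> ?G" if "\<gamma> \<in> \<Gamma>" for \<gamma> using that assms(3) unfolding \<Gamma>_def by blast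
  have "\<exists>\<gamma>\<in>\<Gamma>. s < \<gamma>" if "s < r" for s
  proof -
    have "ereal s < Sup (ereal ` \<Gamma>)" using that assms(1) unfolding sup[symmetric]
      by (metis ereal_less_eq(3) less_ereal.simps(1) order_less_le_trans)
    then show ?thesis unfolding less_Sup_iff by auto
  qed
  then have below: "s / 2 * ?d \<le> ?G" if "s < r" for s
    using that \<Gamma> by (smt (verit) divide_right_mono mult_right_mono zero_le_power2)
  show ?thesis
  proof (rule le_of_le_add_small)
    fix t :: real assume "0 < t" "t \<le> 1"
    then show "r / 2 * ?d \<le> ?G + t * (?d / 2)"
      using below[of "r - t"] by (simp add: algebra_simps diff_divide_distrib)
  qed
qed

text \<open>As \<open>p\<close> is feasible, each positive part at \<open>x\<close> is at most the
  absolute value of that component of \<open>B *v (x - p)\<close>.\<close>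

lemma norm_pos_part_le:
  fixes B :: "real^'d^'m"
  assumes "B *v p \<le> c"
  shows "norm (pos_part (B *v x - c)) \<le> onorm ((*v) B) * norm (x - p)"
proof -
  have "norm (pos_part (B *v x - c)) \<le> norm (B *v (x - p))"
  proof (rule norm_le_componentwise_cart)
    fix i
    have "(B *v p) $ i \<le> c $ i" using assms by (simp add: less_eq_vec_def)
    then show "norm (pos_part (B *v x - c) $ i) \<le> norm ((B *v (x - p)) $ i)"
      unfolding pos_part_def by (simp add: matrix_vector_mult_diff_distrib)
  qed
  also have "\<dots> \<le> onorm ((*v) B) * norm (x - p)"
    by (rule onorm) simp
  finally show ?thesis .
qed

section \<open>Combining the estimates\<close>

text \<open>Here \<open>e\<close> stands for \<open>norm G\<close>, \<open>b\<close> for the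
  operator norm of \<open>B\<close> and \<open>\<kappa>\<close> for \<open>1 / \<gamma>\<close>.
  Square roots are avoided: the square of \<open>2 * e * P - \<alpha> * a\<close> bounds
  \<open>2 * \<alpha> * P * a\<close> by \<open>2 * e * P\<^sup>2 + \<alpha> * D\<close>, and the
  last term is absorbed into \<open>2 * \<alpha> * D\<close>.\<close>

lemma quadratic_growth_solve:
  fixes D a e :: real
  assumes pos: "\<alpha> > 0" "H \<ge> 0" "b \<ge> 0" "L \<ge> 0" "\<kappa> \<ge> 0" "e \<ge> 0"
    and D: "D \<le> H * (a + b * (2 * \<kappa> * (2 * e + L * a)))"
    and a: "\<alpha> * a\<^sup>2 \<le> 2 * e * D"
  shows "D \<le> (8 / \<alpha> * H\<^sup>2 * (1 + b * L * \<kappa>)\<^sup>2 + 8 * H * b * \<kappa>) * e"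
proof (cases "e = 0")
  case True
  then have "\<alpha> * a\<^sup>2 \<le> 0" using a by simp
  then have "a = 0" using pos(1) by (simp add: mult_le_0_iff)
  then show ?thesis using D True by simp
next
  case False
  then have e: "e > 0" using pos by simp
  define P where "P = H * (1 + 2 * b * L * \<kappa>)"
  have D': "D \<le> P * a + 4 * H * b * \<kappa> * e" using D unfolding P_def by (simp add: algebra_simps)
  have "0 \<le> (2 * e * P - \<alpha> * a)\<^sup>2" by simp
  also have "\<dots> = 4 * e\<^sup>2 * P\<^sup>2 - 4 * e * \<alpha> * P * a + \<alpha> * (\<alpha> * a\<^sup>2)"
    by (simp add: power2_eq_square algebra_simps)
  also have "\<dots> \<le> 4 * e\<^sup>2 * P\<^sup>2 - 4 * e * \<alpha> * P * a + \<alpha> * (2 * e * D)"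
    using mult_left_mono[OF a, of \<alpha>] pos(1) by simp
  finally have "0 \<le> (2 * e) * (2 * e * P\<^sup>2 - 2 * \<alpha> * (P * a) + \<alpha> * D)"
    by (simp add: power2_eq_square algebra_simps)
  then have "2 * \<alpha> * (P * a) \<le> 2 * e * P\<^sup>2 + \<alpha> * D" using e by (simp add: zero_le_mult_iff)
  moreover have "2 * \<alpha> * D \<le> 2 * \<alpha> * (P * a + 4 * H * b * \<kappa> * e)"
    using D' pos(1) by simp
  ultimately have *: "\<alpha> * D \<le> 2 * e * P\<^sup>2 + 8 * \<alpha> * H * b * \<kappa> * e" by (simp add: algebra_simps)
  \<comment> \<open>Squaring this factor 2 turns the coefficient 2 of \<open>e * P\<^sup>2\<close>
    into the 8 of the claim.\<close>
  have "P \<le> H * (2 * (1 + b * L * \<kappa>))" unfolding P_def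
    using pos by (intro mult_left_mono) auto
  moreover have "0 \<le> P" unfolding P_def using pos by simp
  ultimately have "P\<^sup>2 \<le> (H * (2 * (1 + b * L * \<kappa>)))\<^sup>2" by (rule power_mono)
  then have "P\<^sup>2 \<le> 4 * H\<^sup>2 * (1 + b * L * \<kappa>)\<^sup>2"
    by (simp add: power2_eq_square algebra_simps)
  then have "2 * e * P\<^sup>2 \<le> 2 * e * (4 * H\<^sup>2 * (1 + b * L * \<kappa>)\<^sup>2)"
    using e by (intro mult_left_mono) auto
  then have "\<alpha> * D \<le> \<alpha> * ((8 / \<alpha> * H\<^sup>2 * (1 + b * L * \<kappa>)\<^sup>2 + 8 * H * b * \<kappa>) * e)"
    using * pos(1) by (simp add: distrib_left distrib_right ac_simps)
  then show ?thesis using pos(1) by simp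
qed


text \<open>\<open>\<kappa>\<close> is \<open>1 / \<gamma>\<close>, read as \<open>0\<close> when \<open>\<gamma> = \<infinity>\<close>; in that case \<open>K\<close> is contained in the minimiser set.\<close>
lemma firm_const_inverse:
  assumes "firm_const K A g \<xi> > 0"
  obtains \<kappa> where "\<kappa> \<ge> 0" "\<And>s. real_of_ereal (ereal s / firm_const K A g \<xi>) = s * \<kappa>"
    "\<And>x. x \<in> K \<Longrightarrow> (infdist x (M_set A g \<xi>))\<^sup>2
      \<le> 2 * \<kappa> * (tilted A g \<xi> x - (INF u\<in>M_set A g \<xi>. tilted A g \<xi> u))"
proof (cases "firm_const K A g \<xi>")
  case (real r)
  then have r: "r > 0" using assms by simp
  show ?thesis
  proof (rule that[of "1 / r"])
    fix x assume "x \<in> K"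
    then show "(infdist x (M_set A g \<xi>))\<^sup>2
      \<le> 2 * (1 / r) * (tilted A g \<xi> x - (INF u\<in>M_set A g \<xi>. tilted A g \<xi> u))"
      using firm_const_bound[of r K A g \<xi> x] real r by (simp add: field_simps)
  qed (use real r in auto)
next
  case PInf
  have "(infdist x (M_set A g \<xi>))\<^sup>2 \<le> 0" if "x \<in> K" for x
  proof (rule ccontr)
    let ?d = "(infdist x (M_set A g \<xi>))\<^sup>2"
      and ?G = "tilted A g \<xi> x - (INF u\<in>M_set A g \<xi>. tilted A g \<xi> u)"
    assume "\<not> ?d \<le> 0"
    then have d: "?d > 0" by simp
    \<comment> \<open>With an infinite supremum this constant is admissible too, and it would force
      the gap \<open>?G\<close> to be at least \<open>\<bar>?G\<bar> + 1 / 2\<close>.\<close>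
    have "(2 * \<bar>?G\<bar> + 1) / ?d > 0" using d by (intro divide_pos_pos add_nonneg_pos) auto
    then have "(2 * \<bar>?G\<bar> + 1) / ?d / 2 * ?d \<le> ?G"
      using PInf that by (intro firm_const_bound) auto
    moreover have "(2 * \<bar>?G\<bar> + 1) / ?d / 2 * ?d = \<bar>?G\<bar> + 1 / 2"
      using d by (simp add: field_simps)
    ultimately show False by linarith
  qed
  then show ?thesis using PInf by (intro that[of 0]) auto
qed (use assms in auto)

lemma closed_matrix_le: "closed {x. B *v x \<le> c}" for B :: "real^'d^'m"
  unfolding less_eq_vec_def
  by (intro closed_Collect_all closed_Collect_le continuous_intros)

theorem proposition3:
  fixes A :: "real^'d^'n" and f :: "real^'n \<Rightarrow> real" and g :: "real^'d \<Rightarrow> real"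
    and \<alpha> L H :: real and K :: "(real^'d) set"
    and ystar \<xi>star :: "real^'n"
    and B :: "real^'d^'m" and c :: "real^'m" and \<gamma> :: ereal
  assumes "\<alpha> > 0" and "strongly_convex \<alpha> f" and "L_smooth L f"
    and "L_smooth L (\<lambda>x. f (A *v x))"
    and "polyhedral_convex g"
    and "opt_set A f g \<noteq> {}"
    and "opt_set A f g \<subseteq> K"
    and "ystar = opt_image A f g"
    and "\<xi>star = grad f ystar"
    and "M_set A g \<xi>star = {x. B *v x \<le> c}"
    and "H = hoffman_const K (opt_set A f g) A ystar B c"
    and "\<gamma> = firm_const K A g \<xi>star" and "\<gamma> > 0"
    and "\<forall>x\<in>K. prox_grad_update L A f g x \<in> K"
  shows "restricted_prox_error_bound K L A f g
     (1 / L
      + 8 / \<alpha> * H\<^sup>2 * (1 + real_of_ereal (ereal (onorm ((*v) B) * L) / \<gamma>))\<^sup>2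
      + real_of_ereal (ereal (8 * H * onorm ((*v) B)) / \<gamma>))"
proof -
  let ?M = "M_set A g \<xi>star" and ?X = "opt_set A f g"
    and ?b = "onorm ((*v) B)" and ?\<nu> = "\<lambda>x. transpose A *v grad f (A *v x)"
  have L: "L > 0" using assms(3) unfolding L_smooth_def by simp
  have b: "?b \<ge> 0" by (rule onorm_pos_le) simp
  have grad_\<phi>: "grad (\<lambda>x. f (A *v x)) x = ?\<nu> x" for x
    using assms(3) unfolding L_smooth_def by (intro grad_eq GDERIV_matrix_compose) blast
  have X_M: "?X = {x. A *v x = ystar} \<inter> ?M"
    unfolding assms(8,9) using assms(1,2,3,5,6) by (rule opt_set_eq)
  have X: "?X = {x. A *v x = ystar \<and> B *v x \<le> c}"
    unfolding X_M assms(10) by blast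
  have cl_M: "closed ?M" unfolding assms(10) by (rule closed_matrix_le)
  have cl_X: "closed ?X"
    unfolding X_M by (intro closed_Int cl_M closed_Collect_eq continuous_intros)
  have ne_M: "?M \<noteq> {}" using assms(6) unfolding X_M by blast
  have M_min: "tilted A g \<xi>star p \<le> tilted A g \<xi>star u" if "p \<in> ?M" for p u
    using that unfolding M_set_def in_argmin_set by blast
  have INF_M: "(INF u\<in>?M. tilted A g \<xi>star u) = tilted A g \<xi>star p" if "p \<in> ?M" for p
    using that M_min by (intro cInf_eq_minimum) auto
  have H: "H \<ge> 0" unfolding assms(11) using X assms(6) by (rule hoffman_const_bound(1))
  obtain \<kappa> where \<kappa>: "\<kappa> \<ge> 0" "\<And>s. real_of_ereal (ereal s / \<gamma>) = s * \<kappa>"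
    "\<And>x. x \<in> K \<Longrightarrow> (infdist x ?M)\<^sup>2
      \<le> 2 * \<kappa> * (tilted A g \<xi>star x - (INF u\<in>?M. tilted A g \<xi>star u))"
    using firm_const_inverse assms(13) unfolding assms(12) by blast
  let ?C = "8 / \<alpha> * H\<^sup>2 * (1 + ?b * L * \<kappa>)\<^sup>2 + 8 * H * ?b * \<kappa>"
  have bound: "infdist x ?X \<le> (1 / L + ?C) * norm (prox_grad_map L A f g x)" if x: "x \<in> K" for x
  proof -
    define z where "z = prox_grad_update L A f g x"
    define G where "G = prox_grad_map L A f g x"
    let ?D = "infdist z ?X" and ?a = "norm (A *v z - ystar)" and ?m = "infdist z ?M"
    \<comment> \<open>Both restricted constants are applied at \<open>z\<close> rather than at
      \<open>x\<close>, hence the invariance of \<open>K\<close>.\<close>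
    have z: "z \<in> K" unfolding z_def using assms(14) x by blast
    have G: "G = L *\<^sub>R (x - z)" unfolding G_def z_def prox_grad_map_def ..
    have nG: "norm G = L * norm (x - z)" unfolding G using L by simp
    have sub: "g u \<ge> g z + (G - ?\<nu> x) \<bullet> (u - z)" for u
      unfolding z_def G_def by (rule prox_grad_update_subgradient[OF L assms(5)])
    obtain q where q: "q \<in> ?X" "?D = dist z q"
      using infdist_attains_inf[OF cl_X assms(6)] by blast
    obtain p where p: "p \<in> ?M" "?m = dist z p"
      using infdist_attains_inf[OF cl_M ne_M] by blast
    have q': "A *v q = ystar" "q \<in> ?M" using q(1) unfolding X_M by auto

    \<comment> \<open>This vector is the subgradient of the composite function at
      \<open>z\<close>.\<close>
    have w: "norm (G - ?\<nu> x + ?\<nu> z) \<le> 2 * norm G"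
    proof -
      have "norm (?\<nu> z - ?\<nu> x) \<le> L * norm (z - x)"
        using L_smooth_bounds(3)[OF assms(4), of z x] unfolding grad_\<phi> .
      then have "norm (?\<nu> z - ?\<nu> x) \<le> norm G" unfolding nG by (simp add: norm_minus_commute)
      then have "norm (G + (?\<nu> z - ?\<nu> x)) \<le> 2 * norm G"
        using norm_triangle_ineq[of G "?\<nu> z - ?\<nu> x"] by linarith
      moreover have "G + (?\<nu> z - ?\<nu> x) = G - ?\<nu> x + ?\<nu> z" by (simp only: add_diff_eq diff_add_eq)
      ultimately show ?thesis by (simp only:)
    qed

    \<comment> \<open>Strong convexity enters twice, linearised at \<open>z\<close> and at
      \<open>q\<close>; each use contributes \<open>\<alpha> / 2 * ?a\<^sup>2\<close>.\<close>
    have growth: "\<alpha> * ?a\<^sup>2 \<le> 2 * norm G * ?D"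
    proof -
      have "f (A *v q) \<ge> f (A *v z) + ?\<nu> z \<bullet> (q - z) + \<alpha> / 2 * ?a\<^sup>2"
        using strongly_convex_grad[OF assms(2,3), of "A *v z" "A *v q"]
        unfolding inner_transpose_matrix q'(1)
        by (simp add: matrix_vector_mult_diff_distrib q'(1) norm_minus_commute)
      then have "composite A f g q
          \<ge> composite A f g z + (G - ?\<nu> x + ?\<nu> z) \<bullet> (q - z) + \<alpha> / 2 * ?a\<^sup>2"
        using sub[of q] unfolding composite_def inner_add_left by linarith
      moreover have "composite A f g z - composite A f g q \<ge> \<alpha> / 2 * ?a\<^sup>2"
        using composite_ge_tilted[OF assms(2,3), of A z q g] M_min[OF q'(2), of z]
        unfolding q'(1) assms(9)[symmetric] by linarith
      ultimately have "\<alpha> * ?a\<^sup>2 \<le> - ((G - ?\<nu> x + ?\<nu> z) \<bullet> (q - z))" by linarith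
      also have "\<dots> \<le> norm (G - ?\<nu> x + ?\<nu> z) * norm (q - z)"
        using Cauchy_Schwarz_ineq2[of "G - ?\<nu> x + ?\<nu> z" "q - z"] by linarith
      also have "\<dots> \<le> 2 * norm G * norm (q - z)" using w by (rule mult_right_mono) simp
      finally show ?thesis unfolding q(2) dist_norm by (simp only: norm_minus_commute)
    qed

    \<comment> \<open>The Lipschitz bound for the composed gradient would only give
      \<open>L * ?D\<close>, and the one for \<open>grad f\<close> would bring in the operator norm
      of \<open>A\<close>.\<close>
    have cocoercive: "norm (?\<nu> z - ?\<nu> q) \<le> L * ?a"
    proof -
      have cv: "f (A *v u) \<ge> f (A *v q) + ?\<nu> q \<bullet> (u - q)" for u
      proof -
        have "f (A *v u) \<ge> f (A *v q) + grad f (A *v q) \<bullet> (A *v u - A *v q)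
            + \<alpha> / 2 * (norm (A *v u - A *v q))\<^sup>2"
          by (rule strongly_convex_grad[OF assms(2,3)])
        moreover have "\<alpha> / 2 * (norm (A *v u - A *v q))\<^sup>2 \<ge> 0" using assms(1) by simp
        ultimately show ?thesis
          unfolding inner_transpose_matrix matrix_vector_mult_diff_distrib by linarith
      qed
      have "(norm (?\<nu> z - ?\<nu> q))\<^sup>2 \<le> 2 * L * (f (A *v z) - f (A *v q) - ?\<nu> q \<bullet> (z - q))"
        using grad_diff_le_Bregman[OF assms(4), of q z] cv unfolding grad_\<phi> by blast
      also have "\<dots> \<le> 2 * L * (L / 2 * ?a\<^sup>2)"
      proof (rule mult_left_mono)
        show "f (A *v z) - f (A *v q) - ?\<nu> q \<bullet> (z - q) \<le> L / 2 * ?a\<^sup>2"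
          using L_smooth_bounds(1)[OF assms(3), of "A *v z" "A *v q"]
          unfolding inner_transpose_matrix matrix_vector_mult_diff_distrib q'(1) by linarith
      qed (use L in simp)
      also have "\<dots> = (L * ?a)\<^sup>2" by (simp add: power2_eq_square)
      finally show ?thesis by (rule power2_le_imp_le) (use L in simp)
    qed

    have m: "?m \<le> 2 * \<kappa> * (2 * norm G + L * ?a)"
    proof -
      \<comment> \<open>With the gradient taken at \<open>q\<close> instead of \<open>z\<close>,
        this is a subgradient at \<open>z\<close> of the tilted function, as \<open>?\<nu> q\<close>
        is its tilt.\<close>
      let ?w = "G - ?\<nu> x + ?\<nu> q"
      have "?w = (G - ?\<nu> x + ?\<nu> z) - (?\<nu> z - ?\<nu> q)" by (simp add: algebra_simps)
      then have nw: "norm ?w \<le> 2 * norm G + L * ?a"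
        using norm_triangle_ineq4[of "G - ?\<nu> x + ?\<nu> z" "?\<nu> z - ?\<nu> q"] w cocoercive
        by (simp only:)
      have "tilted A g \<xi>star p \<ge> tilted A g \<xi>star z + ?w \<bullet> (p - z)"
      proof -
        have "?\<nu> q \<bullet> (p - z) = \<xi>star \<bullet> (A *v p) - \<xi>star \<bullet> (A *v z)"
          unfolding inner_transpose_matrix q'(1) assms(9)[symmetric]
          by (simp add: matrix_vector_mult_diff_distrib inner_diff_right)
        then show ?thesis using sub[of p] unfolding tilted_eq inner_add_left by linarith
      qed
      then have "tilted A g \<xi>star z - (INF u\<in>?M. tilted A g \<xi>star u) \<le> norm ?w * norm (p - z)"
        using Cauchy_Schwarz_ineq2[of ?w "p - z"] unfolding INF_M[OF p(1)] by linarith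
      also have "\<dots> \<le> (2 * norm G + L * ?a) * norm (p - z)" using nw by (rule mult_right_mono) simp
      also have "norm (p - z) = ?m" unfolding p(2) dist_norm by (rule norm_minus_commute)
      finally have gap: "tilted A g \<xi>star z - (INF u\<in>?M. tilted A g \<xi>star u)
          \<le> (2 * norm G + L * ?a) * ?m" .
      \<comment> \<open>Firm convexity is quadratic in \<open>?m\<close> while the gap is bounded
        linearly, so one factor cancels.\<close>
      have "?m\<^sup>2 \<le> 2 * \<kappa> * ((2 * norm G + L * ?a) * ?m)"
        using \<kappa>(3)[OF z] mult_left_mono[OF gap, of "2 * \<kappa>"] \<kappa>(1) by linarith
      then have "?m * ?m \<le> (2 * \<kappa> * (2 * norm G + L * ?a)) * ?m"
        by (simp only: power2_eq_square mult.assoc)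
      then show ?thesis
        using \<kappa>(1) L infdist_nonneg[of z ?M] by (cases "?m = 0") auto
    qed

    have "B *v p \<le> c" using p(1) unfolding assms(10) by simp
    from norm_pos_part_le[OF this, of z]
    have "norm (pos_part (B *v z - c)) \<le> ?b * ?m" unfolding p(2) dist_norm .
    also have "\<dots> \<le> ?b * (2 * \<kappa> * (2 * norm G + L * ?a))" using m b by (rule mult_left_mono)
    finally have "?a + norm (pos_part (B *v z - c)) \<le> ?a + ?b * (2 * \<kappa> * (2 * norm G + L * ?a))"
      by simp
    from mult_left_mono[OF this H]
    have "?D \<le> H * (?a + ?b * (2 * \<kappa> * (2 * norm G + L * ?a)))"
      using hoffman_const_bound(2)[OF X assms(6) z] unfolding assms(11) by linarith
    from quadratic_growth_solve[OF assms(1) H b _ \<kappa>(1) norm_ge_zero this growth]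
    have "?D \<le> ?C * norm G" using L by simp
    \<comment> \<open>Returning from \<open>z\<close> to \<open>x\<close> costs the length of the
      proximal step, which is the summand \<open>1 / L\<close>.\<close>
    moreover have "infdist x ?X \<le> ?D + dist x z" by (rule infdist_triangle)
    moreover have "dist x z = 1 / L * norm G" unfolding nG dist_norm using L by simp
    ultimately show ?thesis unfolding G_def by (simp add: distrib_right)
  qed
  have "?C \<ge> 0" using assms(1) H b \<kappa>(1) by simp
  then have "1 / L + ?C > 0" using L by (simp add: add_pos_nonneg)
  then have "restricted_prox_error_bound K L A f g (1 / L + ?C)"
    unfolding restricted_prox_error_bound_def using bound by blast
  then show ?thesis unfolding \<kappa>(2) by (simp only: add.assoc)
qed

end
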